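(* Let $V$ be the set of all tetrahedron indices and $V_+\subset V$ the set of all $q$-positive tetrahedron indices. Then: (a) $V$ is a free $q$-holonomic $\mathbb Z((q))$-module of rank $2$. (b) $V_+$ is a free $q$-holonomic $\mathbb Z[[q]]$-module of rank $1$. (c) If $f\in V$, then for all integers $m,e$ $$f(m,e)(q)=(-q^{\frac12})^{-e}f(e,-e-m)(q)=(-q^{\frac12})^{m}f(-e-m,m)(q).$$ (d) If $f\in V$, then for all integers $m,e$ $$f(m,e+1)+(q^{e+\frac m2}-q^{-\frac m2}-q^{\frac m2})f(m,e)+f(m,e-1)=0,$$ $$f(m+1,e)+(q^{-\frac e2-m}-q^{-\frac e2}-q^{\frac e2})f(m,e)+f(m-1,e)=0.$$
   Context: $\mathbb Z((q^{1/2}))$ denotes the ring of formal Laurent series in $q^{1/2}$ with integer coefficients (bounded below exponents in $\frac12\mathbb Z$). A tetrahedron index is a function $f:\mathbb Z^2\to\mathbb Z((q^{1/2}))$ satisfying, for all integers $m,e$, $$q^{\frac e2}f(m+1,e)+q^{-\frac m2}f(m,e+1)-f(m,e)=0,$$ $$q^{\frac e2}f(m-1,e)+q^{-\frac m2}f(m,e-1)-f(m,e)=0,$$ together with the parity condition $f(m,e)\in q^{\frac{em}2}\mathbb Z((q))$ for all $m,e$. It is $q$-positive if every $f(m,e)$ has degree $\ge0$, i.e. $f(m,e)\in\mathbb Z[[q^{1/2}]]$ for all $m,e$. "$q$-holonomic" for these modules means that their elements are $q$-holonomic functions of $(m,e)$ in the standard sense of Zeilberger and Wilf--Zeilberger: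 for $f:\mathbb Z^n\to\mathbb Q((q^{1/2}))$ let $(M_jf)(x)=q^{x_j/2}f(x)$ and $(L_jf)(x)=f(x_1,\dots,x_j+1,\dots,x_n)$; $f$ is $q$-holonomic if the $\mathbb Q(q^{1/2})$-dimension of the span of all $M^{\alpha}L^{\beta}f$ with $\alpha,\beta\in\mathbb N^n$, $|\alpha|+|\beta|\le N$, is $O(N^n)$ as $N\to\infty$ (here $n=2$). *)

theory Defs
  imports
    "HOL-Computational_Algebra.Computational_Algebra"
    "HOL-Computational_Algebra.Field_as_Ring"
    "HOL-Library.Function_Algebras"
    "HOL-Library.Landau_Symbols"
begin

text \<open>
  The indeterminate of \<^typ>\<open>int fls\<close> and \<^typ>\<open>rat fls\<close>, when these serve as rings of values,
  is \<open>q\<^sup>1\<^sup>/\<^sup>2\<close>; so \<open>qh k\<close> below is \<open>q\<close> to the power \<open>k/2\<close>.  When \<^typ>\<open>int fls\<close> and \<^typ>\<open>int fps\<close>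
  serve as rings of scalars, the indeterminate is \<open>q\<close>, and \<open>of_q\<close> is the inclusion
  of the Laurent series in \<open>q\<close> into those in \<open>q\<^sup>1\<^sup>/\<^sup>2\<close>.
\<close>

abbreviation qh :: "int \<Rightarrow> 'a::comm_ring_1 fls" where
  "qh k \<equiv> fls_X_intpow k"

definition of_q :: "int fls \<Rightarrow> int fls" where
  "of_q c = fls_compose_power c 2"

text \<open>The integer power \<open>(-q\<^sup>1\<^sup>/\<^sup>2)\<^sup>k\<close>; \<open>powi\<close> needs an inverse, which \<^typ>\<open>int fls\<close> does not have.\<close>

definition neg_qh :: "int \<Rightarrow> int fls" where
  "neg_qh k = (if even k then qh k else - qh k)"

lemma neg_qh_0: "neg_qh 0 = 1"
  by (simp add: neg_qh_def)

lemma neg_qh_1: "neg_qh 1 = - fls_X"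
  by (simp add: neg_qh_def fls_X_conv_shift_1)

lemma neg_qh_add: "neg_qh (j + k) = neg_qh j * neg_qh k"
  by (auto simp: neg_qh_def fls_X_intpow_times_fls_X_intpow)


definition tetrahedron_index :: "(int \<Rightarrow> int \<Rightarrow> int fls) \<Rightarrow> bool" where
  "tetrahedron_index f \<longleftrightarrow>
     (\<forall>m e. qh e * f (m + 1) e + qh (- m) * f m (e + 1) - f m e = 0) \<and>
     (\<forall>m e. qh e * f (m - 1) e + qh (- m) * f m (e - 1) - f m e = 0) \<and>
     (\<forall>m e. \<exists>g. f m e = qh (e * m) * of_q g)"

text \<open>Note that \<open>fls_subdegree 0 = 0\<close>.\<close>

definition q_positive :: "(int \<Rightarrow> int \<Rightarrow> int fls) \<Rightarrow> bool" where
  "q_positive f \<longleftrightarrow> (\<forall>m e. fls_subdegree (f m e) \<ge> 0)"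

definition tet_V :: "(int \<Rightarrow> int \<Rightarrow> int fls) set" where
  "tet_V = {f. tetrahedron_index f}"

definition tet_V_pos :: "(int \<Rightarrow> int \<Rightarrow> int fls) set" where
  "tet_V_pos = {f \<in> tet_V. q_positive f}"


definition laurent_scale ::
    "int fls \<Rightarrow> (int \<Rightarrow> int \<Rightarrow> int fls) \<Rightarrow> (int \<Rightarrow> int \<Rightarrow> int fls)" where
  "laurent_scale c f = (\<lambda>m e. of_q c * f m e)"

definition power_scale ::
    "int fps \<Rightarrow> (int \<Rightarrow> int \<Rightarrow> int fls) \<Rightarrow> (int \<Rightarrow> int \<Rightarrow> int fls)" where
  "power_scale c f = laurent_scale (fps_to_fls c) f"

lemma module_laurent_scale: "module laurent_scale"
  by unfold_locales
     (auto simp: laurent_scale_def of_q_def fun_eq_iff algebra_simps)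

lemma module_power_scale: "module power_scale"
  by unfold_locales
     (auto simp: power_scale_def laurent_scale_def of_q_def fun_eq_iff algebra_simps
                 fls_times_fps_to_fls)

definition free_module_of_rank ::
    "('r::comm_ring_1 \<Rightarrow> 'a::ab_group_add \<Rightarrow> 'a) \<Rightarrow> 'a set \<Rightarrow> nat \<Rightarrow> bool" where
  "free_module_of_rank scale V n \<longleftrightarrow>
     module scale \<and> module.subspace scale V \<and>
     (\<exists>B. finite B \<and> card B = n \<and> \<not> module.dependent scale B \<and> module.span scale B = V)"


lift_definition fls_of_int_coeffs :: "int fls \<Rightarrow> rat fls" is "\<lambda>f n. of_int (f n)"
  by (auto elim: eventually_mono)

text \<open>The inclusion of the field of rational functions in \<open>q\<^sup>1\<^sup>/\<^sup>2\<close> into the Laurent series.\<close>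

definition fls_of_fract :: "rat poly fract \<Rightarrow> rat fls" where
  "fls_of_fract c =
     (case quot_of_fract c of (p, r) \<Rightarrow> fps_to_fls (fps_of_poly p) / fps_to_fls (fps_of_poly r))"

lemma fls_of_fract_Fract:
  assumes "r \<noteq> 0"
  shows "fls_of_fract (Fract p r) = fps_to_fls (fps_of_poly p) / fps_to_fls (fps_of_poly r)"
proof -
  obtain p' r' where pr: "quot_of_fract (Fract p r) = (p', r')"
    by fastforce
  have r': "r' \<noteq> 0"
    using snd_quot_of_fract_nonzero[of "Fract p r"] pr by simp
  have "Fract p' r' = Fract p r"
    using Fract_quot_of_fract[of "Fract p r"] pr by simp
  hence "p' * r = p * r'"
    using assms r' by (simp add: eq_fract)
  hence "fps_to_fls (fps_of_poly p') * fps_to_fls (fps_of_poly r) =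
         fps_to_fls (fps_of_poly p) * fps_to_fls (fps_of_poly r')"
    by (metis fls_times_fps_to_fls fps_of_poly_mult)
  thus ?thesis
    using assms r' pr by (simp add: fls_of_fract_def frac_eq_eq)
qed

lemma fls_of_fract_1: "fls_of_fract 1 = 1"
  by (simp add: fls_of_fract_def)

lemma fls_of_fract_add: "fls_of_fract (a + b) = fls_of_fract a + fls_of_fract b"
  by (cases a; cases b)
     (simp add: fls_of_fract_Fract fps_of_poly_add fps_of_poly_mult
                fls_times_fps_to_fls divide_simps)

lemma fls_of_fract_mult: "fls_of_fract (a * b) = fls_of_fract a * fls_of_fract b"
  by (cases a; cases b)
     (simp add: fls_of_fract_Fract fps_of_poly_mult fls_times_fps_to_fls)

definition ratfun_scale ::
    "rat poly fract \<Rightarrow> (int \<Rightarrow> int \<Rightarrow> rat fls) \<Rightarrow> (int \<Rightarrow> int \<Rightarrow> rat fls)" where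
  "ratfun_scale c f = (\<lambda>m e. fls_of_fract c * f m e)"

lemma vector_space_ratfun_scale: "vector_space ratfun_scale"
  by unfold_locales
     (simp_all add: ratfun_scale_def fls_of_fract_1 fls_of_fract_add fls_of_fract_mult
                    fun_eq_iff algebra_simps)

definition M1 :: "(int \<Rightarrow> int \<Rightarrow> rat fls) \<Rightarrow> (int \<Rightarrow> int \<Rightarrow> rat fls)" where
  "M1 f = (\<lambda>x y. qh x * f x y)"
definition M2 :: "(int \<Rightarrow> int \<Rightarrow> rat fls) \<Rightarrow> (int \<Rightarrow> int \<Rightarrow> rat fls)" where
  "M2 f = (\<lambda>x y. qh y * f x y)"
definition L1 :: "(int \<Rightarrow> int \<Rightarrow> rat fls) \<Rightarrow> (int \<Rightarrow> int \<Rightarrow> rat fls)" where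
  "L1 f = (\<lambda>x y. f (x + 1) y)"
definition L2 :: "(int \<Rightarrow> int \<Rightarrow> rat fls) \<Rightarrow> (int \<Rightarrow> int \<Rightarrow> rat fls)" where
  "L2 f = (\<lambda>x y. f x (y + 1))"

definition monomials_upto :: "(int \<Rightarrow> int \<Rightarrow> rat fls) \<Rightarrow> nat \<Rightarrow> (int \<Rightarrow> int \<Rightarrow> rat fls) set" where
  "monomials_upto f N =
     {(M1 ^^ a1) ((M2 ^^ a2) ((L1 ^^ b1) ((L2 ^^ b2) f))) | a1 a2 b1 b2.
        a1 + a2 + b1 + b2 \<le> N}"

definition q_holonomic :: "(int \<Rightarrow> int \<Rightarrow> rat fls) \<Rightarrow> bool" where
  "q_holonomic f \<longleftrightarrow>
     (\<lambda>N. real (vector_space.dim ratfun_scale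
                  (module.span ratfun_scale (monomials_upto f N)))) \<in> O(\<lambda>N. real N ^ 2)"

definition q_holonomic_set :: "(int \<Rightarrow> int \<Rightarrow> int fls) set \<Rightarrow> bool" where
  "q_holonomic_set V \<longleftrightarrow> (\<forall>f\<in>V. q_holonomic (\<lambda>m e. fls_of_int_coeffs (f m e)))"

end

theory Submission
  imports Defs "HOL-Library.Nat_Bijection"
begin

text \<open>
  Write \<open>x = q\<^sup>1\<^sup>/\<^sup>2\<close> for the indeterminate of the value ring.  Join the points of the
  lattice \<open>\<int>\<^sup>2\<close> by its horizontal and vertical edges and by the edges from \<open>(m + 1, e)\<close> to
  \<open>(m, e + 1)\<close>.  This is a triangular lattice, and the two relations say that each of its triangles
  carries a linear relation between the values at the three corners, with all coefficients powers of
  \<open>x\<close> up to sign.  Two values at the corners of a triangle therefore determine the third.  Going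
  around the six triangles at a vertex gives back the value one started from, so the relations are
  consistent: a solution is determined by its values at \<open>(0, 0)\<close> and \<open>(0, 1)\<close>, and these can be
  prescribed.  The parity condition is carried along from triangle to triangle, so the two initial
  values range freely over the Laurent series in \<open>q\<close>, which gives rank 2.

  Consistency is organised by rows (fixed \<open>m\<close>).  The relations express the row \<open>m + 1\<close> by the row
  \<open>m\<close> (\<open>row_up\<close>) and the row \<open>m\<close> by the row \<open>m + 1\<close> (\<open>row_down\<close>); eliminating one of them leaves
  the three-term recursion within a row.  On rows that satisfy this recursion the two passages are
  inverse to each other and preserve the recursion (\<open>row_down_up\<close>, \<open>row_recursion_up\<close> and their
  counterparts), and a row itself is determined by two adjacent entries.

  For the symmetry, the rotation of order 3 of the triangular lattice, twisted by a power of \<open>-x\<close>,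
  maps solutions to solutions and does not change the two initial values, so it fixes every
  solution.

  For the \<open>q\<close>-positive solutions there are two points.  If such a solution vanishes at \<open>(0, 0)\<close>
  but not everywhere, then along \<open>(0, -1), (0, -2), \<dots>\<close> the recursion multiplies the lowest term, up to sign, by
  \<open>q\<^sup>-\<^sup>1, q\<^sup>-\<^sup>2, \<dots>\<close> in turn, and the degree tends to \<open>-\<infinity>\<close>; hence a \<open>q\<close>-positive solution is
  determined by its value at \<open>(0, 0)\<close>.  On the other hand the series
  \<open>\<Sum>\<^sub>n (-1)\<^sup>n q\<^bsup>n(n+1)/2 - (n + e/2) m\<^esup> / ((q)\<^sub>n (q)\<^sub>n\<^sub>+\<^sub>e)\<close> is visibly \<open>q\<close>-positive in the quadrant
  \<open>m \<le> 0 \<le> e\<close>, and the symmetry moves every lattice point into this quadrant at the cost of a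
  nonnegative power of \<open>-x\<close>.  Its value at \<open>(0, 0)\<close> has constant term 1, so it is a unit, and the
  series generates.

  Finally, by the relations every shift of a solution \<open>f\<close> is a combination of \<open>f\<close> and of its shift by
  one in \<open>e\<close>, with coefficients that are Laurent polynomials in \<open>x\<^sup>m\<close> and \<open>x\<^sup>e\<close> whose degree grows
  linearly with the shift.  There are only quadratically many monomials of bounded degree, which is
  \<open>q\<close>-holonomicity.
\<close>

unbundle fps_syntax

section \<open>Powers of the indeterminate\<close>

text \<open>
  The simplifier turns \<open>qh (- k)\<close> into \<open>fls_shift k 1\<close>.  Rules about products of powers that are to
  fire on its normal forms must thus be stated for shifts of 1, and the last one is for a factor that
  the term order places between two powers.
\<close>

lemma shift_1_mult_shift_1: "fls_shift i 1 * fls_shift j 1 = (fls_shift (i + j) 1 :: 'a::comm_ring_1 fls)"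
  by (simp add: fls_shifted_times_simps)

lemma shift_1_mult_left:
  "fls_shift i 1 * (fls_shift j 1 * c) = fls_shift (i + j) 1 * (c :: 'a::comm_ring_1 fls)"
  by (simp add: shift_1_mult_shift_1 flip: mult.assoc)

lemma shift_1_mult_right:
  "fls_shift i 1 * (c * fls_shift j 1) = fls_shift (i + j) 1 * (c :: 'a::comm_ring_1 fls)"
  by (metis shift_1_mult_left mult.commute)

lemmas qh_simps = shift_1_mult_shift_1 shift_1_mult_left shift_1_mult_right

lemma qh_mult_cancel: "qh k * a = qh k * b \<longleftrightarrow> a = (b :: 'a::comm_ring_1 fls)"
proof
  assume "qh k * a = qh k * b"
  hence "qh (-k) * (qh k * a) = qh (-k) * (qh k * b)" by simp
  thus "a = b" by (simp add: qh_simps)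
qed simp

section \<open>The relations in terms of rows\<close>

definition tet_relations :: "(int \<Rightarrow> int \<Rightarrow> int fls) \<Rightarrow> bool" where
  "tet_relations f \<longleftrightarrow>
     (\<forall>m e. qh e * f (m + 1) e + qh (- m) * f m (e + 1) = f m e) \<and>
     (\<forall>m e. qh e * f (m - 1) e + qh (- m) * f m (e - 1) = f m e)"

lemma tet_relationsD:
  assumes "tet_relations f"
  shows "qh e * f (m + 1) e + qh (- m) * f m (e + 1) = f m e"
    and "qh e * f (m - 1) e + qh (- m) * f m (e - 1) = f m e"
  using assms by (auto simp: tet_relations_def)

definition row_recursion :: "int \<Rightarrow> (int \<Rightarrow> int fls) \<Rightarrow> bool" where
  "row_recursion m u \<longleftrightarrow>
     (\<forall>e. u (e + 1) + (qh (2 * e + m) - qh (- m) - qh m) * u e + u (e - 1) = 0)"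

definition row_up :: "int \<Rightarrow> (int \<Rightarrow> int fls) \<Rightarrow> (int \<Rightarrow> int fls)" where
  "row_up m u = (\<lambda>e. qh (- e) * (u e - qh (- m) * u (e + 1)))"

definition row_down :: "int \<Rightarrow> (int \<Rightarrow> int fls) \<Rightarrow> (int \<Rightarrow> int fls)" where
  "row_down m u = (\<lambda>e. qh (- e) * (u e - qh (- m) * u (e - 1)))"

lemma tet_relations_iff_rows:
  "tet_relations f \<longleftrightarrow>
     (\<forall>m. f (m + 1) = row_up m (f m)) \<and> (\<forall>m. f (m - 1) = row_down m (f m))"
proof -
  have *: "qh e * a + b = c \<longleftrightarrow> a = qh (- e) * (c - b)" for e and a b c :: "int fls"
    by (subst qh_mult_cancel [of e, symmetric]) (auto simp: qh_simps algebra_simps)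
  show ?thesis
    by (simp add: tet_relations_def row_up_def row_down_def fun_eq_iff *)
qed

lemma row_recursionD:
  assumes "row_recursion m u"
  shows "u (e + 1) = (qh m + qh (- m) - qh (2 * e + m)) * u e - u (e - 1)"
  using assms unfolding row_recursion_def by (simp add: algebra_simps) (metis add_diff_cancel_left' diff_add_cancel)

text \<open>
  This and the next three lemmas are the consistency of the relations around a vertex: substituting
  the definitions and eliminating the outermost entries of \<open>u\<close> by the recursion leaves an identity
  between powers of the indeterminate.
\<close>
lemma row_down_up:
  assumes "row_recursion m u" shows "row_down (m + 1) (row_up m u) = u"
proof
  fix e
  have [simp]: "u (1 + e) = (qh m + qh (- m) - qh (2 * e + m)) * u e - u (e - 1)"
    using row_recursionD [OF assms, of e] by (simp add: add.commute)
  show "row_down (m + 1) (row_up m u) e = u e"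
    by (simp add: row_down_def row_up_def algebra_simps qh_simps)
qed

lemma row_up_down:
  assumes "row_recursion m u" shows "row_up (m - 1) (row_down m u) = u"
proof
  fix e
  have [simp]: "u (1 + e) = (qh m + qh (- m) - qh (2 * e + m)) * u e - u (e - 1)"
    using row_recursionD [OF assms, of e] by (simp add: add.commute)
  show "row_up (m - 1) (row_down m u) e = u e"
    by (simp add: row_down_def row_up_def algebra_simps qh_simps)
qed

lemma row_recursion_up:
  assumes "row_recursion m u" shows "row_recursion (m + 1) (row_up m u)"
  unfolding row_recursion_def
proof
  fix e
  have [simp]: "u (1 + e) = (qh m + qh (- m) - qh (2 * e + m)) * u e - u (e - 1)"
    using row_recursionD [OF assms, of e] by (simp add: add.commute)
  have [simp]: "u (e + 2) = (qh m + qh (- m) - qh (2 * (e + 1) + m)) * u (e + 1) - u e"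
    using row_recursionD [OF assms, of "e + 1"] by (simp add: add.assoc)
  show "row_up m u (e + 1) + (qh (2 * e + (m + 1)) - qh (- (m + 1)) - qh (m + 1)) * row_up m u e
          + row_up m u (e - 1) = 0"
    by (simp add: row_up_def algebra_simps qh_simps)
qed

lemma row_recursion_down:
  assumes "row_recursion m u" shows "row_recursion (m - 1) (row_down m u)"
  unfolding row_recursion_def
proof
  fix e
  have [simp]: "u (1 + e) = (qh m + qh (- m) - qh (2 * e + m)) * u e - u (e - 1)"
    using row_recursionD [OF assms, of e] by (simp add: add.commute)
  have [simp]: "u (e - 2) = (qh m + qh (- m) - qh (2 * (e - 1) + m)) * u (e - 1) - u e"
    using row_recursionD [OF assms, of "e - 1"] by (simp add: algebra_simps)
  show "row_down m u (e + 1) + (qh (2 * e + (m - 1)) - qh (- (m - 1)) - qh (m - 1)) * row_down m u e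
          + row_down m u (e - 1) = 0"
    by (simp add: row_down_def algebra_simps qh_simps)
qed

text \<open>
  Passing from the row \<open>m\<close> to the row \<open>m + 1\<close> and back involves three adjacent entries of the row
  \<open>m\<close>, and the result must be the middle one.
\<close>
lemma tet_relations_row_recursion:
  assumes "tet_relations f" shows "row_recursion m (f m)"
  unfolding row_recursion_def
proof
  fix e
  note r = tet_relations_iff_rows[THEN iffD1, OF assms]
  have *: "f m = row_down (m + 1) (row_up m (f m))"
    using r by (metis add_diff_cancel_right')
  have "f m e = row_down (m + 1) (row_up m (f m)) e"
    by (rule fun_cong [OF *])
  hence "qh (2 * e + m) * f m e = qh (2 * e + m) * row_down (m + 1) (row_up m (f m)) e"
    by simp
  thus "f m (e + 1) + (qh (2 * e + m) - qh (- m) - qh m) * f m e + f m (e - 1) = 0"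
    by (simp add: row_down_def row_up_def algebra_simps qh_simps)
qed

text \<open>
  The entries above and below \<open>(m, e)\<close> are combinations of the row \<open>m\<close>, whose recursion then
  eliminates everything but the entry at \<open>(m, e)\<close>.
\<close>
lemma tet_relations_column_recursion:
  assumes "tet_relations f"
  shows "f (m + 1) e + (qh (- e - 2 * m) - qh (- e) - qh e) * f m e + f (m - 1) e = 0"
proof -
  note r = tet_relations_iff_rows[THEN iffD1, OF assms]
  have [simp]: "f m (1 + e) = (qh m + qh (- m) - qh (2 * e + m)) * f m e - f m (e - 1)"
    using row_recursionD [OF tet_relations_row_recursion [OF assms], of m e] by (simp add: add.commute)
  have [simp]: "f (1 + m) = row_up m (f m)" "f (m + 1) = row_up m (f m)" "f (m - 1) = row_down m (f m)" using r
    by (auto simp: add.commute)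
  show ?thesis
    by (simp add: row_down_def row_up_def algebra_simps qh_simps)
qed

lemma int_recursion_two_sided_eqI:
  fixes u v :: "int \<Rightarrow> 'a"
  assumes "u 0 = v 0" "\<And>n. n \<ge> 0 \<Longrightarrow> u n = v n \<Longrightarrow> u (n + 1) = v (n + 1)"
    "\<And>n. n \<le> 0 \<Longrightarrow> u n = v n \<Longrightarrow> u (n - 1) = v (n - 1)"
  shows "u = v"
proof
  fix n show "u n = v n"
    by (induction n rule: int_induct [where k = 0]) (auto intro: assms)
qed

lemma row_recursion_eqI:
  assumes u: "row_recursion m u" and v: "row_recursion m v"
    and "u 0 = v 0" "u 1 = v 1"
  shows "u = v"
proof -
  have 1: "w (2 + e) = (qh m + qh (- m) - qh (2 * (e + 1) + m)) * w (e + 1) - w e"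
    if "row_recursion m w" for w e
    using row_recursionD [OF that, of "e + 1"] by (simp add: add.commute add.left_commute)
  have 2: "w (e - 1) = (qh m + qh (- m) - qh (2 * e + m)) * w e - w (e + 1)"
    if "row_recursion m w" for w e
    using row_recursionD [OF that, of "e"] by simp
  have "(\<lambda>e. (u e, u (e + 1))) = (\<lambda>e. (v e, v (e + 1)))"
    by (rule int_recursion_two_sided_eqI) (use assms in \<open>auto simp: 1 2\<close>)
  thus ?thesis by (metis prod.inject ext)
qed

lemma tet_relations_eqI:
  assumes f: "tet_relations f" and g: "tet_relations g"
    and "f 0 0 = g 0 0" "f 0 1 = g 0 1"
  shows "f = g"
proof (rule int_recursion_two_sided_eqI)
  show "f 0 = g 0"
    using assms by (intro row_recursion_eqI [of 0] tet_relations_row_recursion)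
qed (use f g in \<open>auto simp: tet_relations_iff_rows\<close>)

section \<open>The symmetry of order three\<close>

definition rotated_index :: "(int \<Rightarrow> int \<Rightarrow> int fls) \<Rightarrow> (int \<Rightarrow> int \<Rightarrow> int fls)" where
  "rotated_index f = (\<lambda>m e. neg_qh (- e) * f e (- e - m))"

text \<open>
  The map \<open>(m, e) \<mapsto> (e, - e - m)\<close> permutes the triangles of each of the two orientations, and the
  sign and power in front turn the relation of the image triangle, solved for another of its corners,
  into the required one.
\<close>
lemma tet_relations_rotated_index:
  assumes "tet_relations f" shows "tet_relations (rotated_index f)"
proof -
  have "qh e * rotated_index f (m + 1) e + qh (- m) * rotated_index f m (e + 1) = rotated_index f m e" for m e
  proof -
    obtain k where m: "m = - e - k - 1" by (metis add_diff_cancel_left' diff_add_cancel)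
    have "f e k = qh k * f (e + 1) k + qh (- e) * f e (k + 1)"
      using tet_relationsD(1) [OF assms, of k e] by simp
    thus ?thesis unfolding m
      by (cases "even e") (simp_all add: rotated_index_def neg_qh_def algebra_simps qh_simps)
  qed
  moreover have "qh e * rotated_index f (m - 1) e + qh (- m) * rotated_index f m (e - 1) = rotated_index f m e" for m e
  proof -
    obtain k where m: "m = 1 - e - k" by (metis add_diff_cancel_left' diff_add_cancel)
    have "f e k = qh k * f (e - 1) k + qh (- e) * f e (k - 1)"
      using tet_relationsD(2) [OF assms, of k e] by simp
    thus ?thesis unfolding m
      by (cases "even e") (simp_all add: rotated_index_def neg_qh_def algebra_simps qh_simps)
  qed
  ultimately show ?thesis by (simp add: tet_relations_def)
qed

text \<open>
  Both sides agree at \<open>(0, 0)\<close> trivially and at \<open>(0, 1)\<close> by the two triangles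
  that lie between \<open>(0, 1)\<close> and its image \<open>(1, -1)\<close>.
\<close>
lemma rotated_index_eq:
  assumes "tet_relations f" shows "rotated_index f = f"
proof (rule tet_relations_eqI)
  have 1: "f 1 0 = f 0 0 + qh (- 1) * f 1 (- 1)"
    using tet_relationsD(2) [OF assms, of 0 1] by simp
  have "f 0 1 = f 0 0 - f 1 0"
    using tet_relationsD(1) [OF assms, of 0 0] by (simp add: eq_diff_eq add.commute)
  also have "\<dots> = - (qh (- 1) * f 1 (- 1))"
    by (subst 1) simp
  finally have "f 0 1 = - (qh (- 1) * f 1 (- 1))" .
  thus "rotated_index f 0 1 = f 0 1" by (simp add: rotated_index_def neg_qh_def)
  show "rotated_index f 0 0 = f 0 0" by (simp add: rotated_index_def neg_qh_def)
qed (use assms in \<open>auto intro: tet_relations_rotated_index\<close>)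

lemma tet_relations_symmetry:
  assumes "tet_relations f"
  shows "f m e = neg_qh (- e) * f e (- e - m)" and "f m e = neg_qh m * f (- e - m) m"
proof -
  have *: "f m e = neg_qh (- e) * f e (- e - m)" for m e
    using rotated_index_eq [OF assms] by (metis rotated_index_def)
  show "f m e = neg_qh (- e) * f e (- e - m)" by (rule *)
  also have "\<dots> = neg_qh (- e) * (neg_qh (e + m) * f (- e - m) m)"
    using *[of e "- e - m"] by (simp add: algebra_simps)
  also have "\<dots> = neg_qh m * f (- e - m) m"
    by (simp flip: mult.assoc neg_qh_add)
  finally show "f m e = neg_qh m * f (- e - m) m" .
qed

section \<open>Existence of solutions with given initial values\<close>

text \<open>
  The sequence is glued from the forward and the backward orbit of \<open>x\<close>.  It is used twice: within
  a row, with pairs of adjacent entries as states, and from row to row.  The invariant \<open>P\<close> is there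
  because the steps from row to row are inverse to each other only on rows that satisfy the
  recursion.
\<close>
lemma two_sided_orbit_exists:
  fixes up down :: "int \<Rightarrow> 'a \<Rightarrow> 'a" and P :: "int \<Rightarrow> 'a \<Rightarrow> bool"
  assumes "P 0 x"
    and up: "\<And>m x. P m x \<Longrightarrow> P (m + 1) (up m x)"
    and down: "\<And>m x. P m x \<Longrightarrow> P (m - 1) (down m x)"
    and du: "\<And>m x. P m x \<Longrightarrow> down (m + 1) (up m x) = x"
    and ud: "\<And>m x. P m x \<Longrightarrow> up (m - 1) (down m x) = x"
  shows "\<exists>g. g 0 = x \<and> (\<forall>m. P m (g m) \<and> g (m + 1) = up m (g m) \<and> g (m - 1) = down m (g m))"
proof -
  define a where "a = rec_nat x (\<lambda>n. up (int n))"
  define b where "b = rec_nat x (\<lambda>n. down (- int n))"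
  have a: "a 0 = x" "a (Suc n) = up (int n) (a n)" for n by (simp_all add: a_def)
  have b: "b 0 = x" "b (Suc n) = down (- int n) (b n)" for n by (simp_all add: b_def)
  have Pa: "P (int n) (a n)" for n
  proof (induction n)
    case (Suc n)
    from up [OF this] show ?case by (simp add: a add.commute)
  qed (use \<open>P 0 x\<close> in \<open>simp add: a\<close>)
  have Pb: "P (- int n) (b n)" for n
  proof (induction n)
    case (Suc n)
    have "- int (Suc n) = - int n - 1" by simp
    with down [OF Suc] show ?case by (simp only: b)
  qed (use \<open>P 0 x\<close> in \<open>simp add: b\<close>)
  define g where "g m = (if m \<ge> 0 then a (nat m) else b (nat (- m)))" for m
  have P: "P m (g m)" for m
    using Pa[of "nat m"] Pb[of "nat (- m)"] by (auto simp: g_def)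
  have g_up: "g (m + 1) = up m (g m)" for m
  proof (cases "m \<ge> 0")
    case True
    thus ?thesis by (simp add: g_def nat_add_distrib a)
  next
    case False
    define n where "n = nat (- m - 1)"
    have m: "m = - int n - 1" using False by (simp add: n_def)
    have "g (- int n) = b n" by (cases n) (simp_all add: g_def a b nat_add_distrib)
    moreover have "g m = down (- int n) (b n)"
      by (simp add: m g_def nat_add_distrib b)
    ultimately show ?thesis using ud [OF Pb] by (simp add: m)
  qed
  moreover have "g (m - 1) = down m (g m)" for m
    using du [OF P, of "m - 1"] g_up [of "m - 1"] by simp
  ultimately show ?thesis
    using P by (intro exI [of _ g]) (simp add: g_def a)
qed

lemma of_q_nth: "of_q c $$ n = (if even n then c $$ (n div 2) else 0)"
  by (simp add: of_q_def fls_nth_compose_power)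

lemma of_q_simps [simp]:
  "of_q 0 = 0" "of_q 1 = 1" "of_q (a + b) = of_q a + of_q b" "of_q (a - b) = of_q a - of_q b"
  "of_q (a * b) = of_q a * of_q b" "of_q (qh k) = qh (2 * k)"
  by (simp_all add: of_q_def)

lemma of_q_eq_iff [simp]: "of_q a = of_q b \<longleftrightarrow> a = b"
proof
  assume *: "of_q a = of_q b"
  show "a = b"
  proof (rule fls_eqI)
    fix n show "a $$ n = b $$ n"
      using arg_cong [OF *, of "\<lambda>f. f $$ (2 * n)"] by (simp add: of_q_nth)
  qed
qed simp

lemma of_q_eq_0_iff [simp]: "of_q a = 0 \<longleftrightarrow> a = 0"
  using of_q_eq_iff [of a 0] by simp

text \<open>
  The parity condition in terms of coefficients, where its stability under sums and
  under multiplication by powers of the indeterminate is immediate.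
\<close>
definition has_parity :: "int \<Rightarrow> int fls \<Rightarrow> bool" where
  "has_parity p f \<longleftrightarrow> (\<forall>n. odd (n - p) \<longrightarrow> f $$ n = 0)"

lemma has_parity_cong: "even (p - p') \<Longrightarrow> has_parity p' f \<Longrightarrow> has_parity p f"
  unfolding has_parity_def by (metis diff_add_cancel even_add even_diff)

lemma has_parity_add: "has_parity p f \<Longrightarrow> has_parity p g \<Longrightarrow> has_parity p (f + g)"
  and has_parity_diff: "has_parity p f \<Longrightarrow> has_parity p g \<Longrightarrow> has_parity p (f - g)"
  and has_parity_uminus: "has_parity p f \<Longrightarrow> has_parity p (- f)"
  by (auto simp: has_parity_def)

lemma has_parity_qh_mult: "has_parity p f \<Longrightarrow> has_parity (k + p) (qh k * f)"
  unfolding has_parity_def by (simp add: fls_X_intpow_times_conv_shift flip: diff_diff_eq)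

lemma has_parity_iff: "has_parity p f \<longleftrightarrow> (\<exists>g. f = qh p * of_q g)"
proof
  assume f: "has_parity p f"
  obtain N where N: "\<And>n. n < N \<Longrightarrow> f $$ n = 0"
    using fls_eq0_below_subdegree by blast
  define g where "g = Abs_fls (\<lambda>n. f $$ (2 * n + p))"
  have g: "g $$ n = f $$ (2 * n + p)" for n
    unfolding g_def
    by (rule nth_Abs_fls_lower_bound [where N = "- \<bar>N\<bar> - \<bar>p\<bar>"]) (auto intro: N)
  \<comment> \<open>Only the coefficients at exponents congruent to \<open>p\<close> modulo 2 survive, and \<open>g\<close> collects them.\<close>
  have "f = qh p * of_q g"
  proof (rule fls_eqI)
    fix n show "f $$ n = (qh p * of_q g) $$ n"
      using f by (auto simp: fls_X_intpow_times_conv_shift of_q_nth g has_parity_def)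
  qed
  thus "\<exists>g. f = qh p * of_q g" ..
qed (auto simp: has_parity_def fls_X_intpow_times_conv_shift of_q_nth)

lemma has_parity_0_iff: "has_parity 0 f \<longleftrightarrow> (\<exists>g. f = of_q g)"
  using has_parity_iff [of 0 f] by simp

lemma tetrahedron_index_iff:
  "tetrahedron_index f \<longleftrightarrow> tet_relations f \<and> (\<forall>m e. has_parity (e * m) (f m e))"
  by (auto simp: tetrahedron_index_def tet_relations_def has_parity_iff)

lemma has_parity_row_up:
  assumes "\<And>e. has_parity (e * m) (u e)" shows "has_parity (e * (m + 1)) (row_up m u e)"
proof -
  have "has_parity (- m + (e + 1) * m) (qh (- m) * u (e + 1))"
    by (intro has_parity_qh_mult assms)
  hence "has_parity (- e + e * m) (row_up m u e)"
    unfolding row_up_def by (intro has_parity_qh_mult has_parity_diff assms) (simp add: algebra_simps)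
  moreover have "e * (m + 1) - (- e + e * m) = 2 * e" by (simp add: algebra_simps)
  ultimately show ?thesis using has_parity_cong by (metis dvd_triv_left)
qed

lemma has_parity_row_down:
  assumes "\<And>e. has_parity (e * m) (u e)" shows "has_parity (e * (m - 1)) (row_down m u e)"
proof -
  have "has_parity (- m + (e - 1) * m) (qh (- m) * u (e - 1))"
    by (intro has_parity_qh_mult assms)
  hence "has_parity (e * m) (qh (- m) * u (e - 1))"
    by (rule has_parity_cong [rotated]) (simp add: algebra_simps)
  hence "has_parity (- e + e * m) (row_down m u e)"
    unfolding row_down_def by (intro has_parity_qh_mult has_parity_diff assms)
  thus ?thesis by (simp add: algebra_simps)
qed

lemma tetrahedron_index_exists_from_row:
  assumes "row_recursion 0 u" "\<And>e. has_parity 0 (u e)"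
  shows "\<exists>f. tetrahedron_index f \<and> f 0 = u"
proof -
  define P where "P m v \<longleftrightarrow> row_recursion m v \<and> (\<forall>e. has_parity (e * m) (v e))" for m v
  have "\<exists>f. f 0 = u \<and>
          (\<forall>m. P m (f m) \<and> f (m + 1) = row_up m (f m) \<and> f (m - 1) = row_down m (f m))"
  proof (rule two_sided_orbit_exists)
    show "P 0 u" using assms by (simp add: P_def)
  qed (simp_all add: P_def row_recursion_up row_recursion_down row_up_down row_down_up
                     has_parity_row_up has_parity_row_down)
  thus ?thesis
    unfolding tetrahedron_index_iff tet_relations_iff_rows P_def by blast
qed

text \<open>
  The recursion expresses the pair of entries at \<open>e + 1, e + 2\<close> by the pair at \<open>e, e + 1\<close> and
  conversely.  In the row \<open>m = 0\<close> its coefficients are series in \<open>q\<close>, which preserves parity.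
\<close>
lemma row_exists:
  assumes "has_parity 0 a" "has_parity 0 b"
  shows "\<exists>u. row_recursion 0 u \<and> (\<forall>e. has_parity 0 (u e)) \<and> u 0 = a \<and> u 1 = b"
proof -
  define c :: "int \<Rightarrow> int fls" where "c e = qh (2 * e) - 1 - 1" for e
  have c: "has_parity 0 (c e * f)" if "has_parity 0 f" for e f
  proof -
    have "has_parity (2 * e + 0) (qh (2 * e) * f)"
      by (intro has_parity_qh_mult that)
    hence "has_parity 0 (qh (2 * e) * f)"
      by (rule has_parity_cong [rotated]) simp
    hence "has_parity 0 (qh (2 * e) * f - f - f)"
      by (intro has_parity_diff that)
    thus ?thesis by (simp add: c_def algebra_simps)
  qed
  define P :: "int \<Rightarrow> int fls \<times> int fls \<Rightarrow> bool"
    where "P e p \<longleftrightarrow> has_parity 0 (fst p) \<and> has_parity 0 (snd p)" for e p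
  define up where "up e p = (snd p, - (c (e + 1) * snd p) - fst p)" for e p
  define down where "down e p = (- (c e * fst p) - snd p, fst p)" for e p
  have "\<exists>g. g 0 = (a, b) \<and> (\<forall>e. P e (g e) \<and> g (e + 1) = up e (g e) \<and> g (e - 1) = down e (g e))"
    by (rule two_sided_orbit_exists)
       (simp_all add: assms P_def up_def down_def c has_parity_diff has_parity_uminus)
  then obtain g where g0: "g 0 = (a, b)" and g: "\<And>e. has_parity 0 (fst (g e))"
    "\<And>e. g (e + 1) = (snd (g e), - (c (e + 1) * snd (g e)) - fst (g e))"
    "\<And>e. g (e - 1) = (- (c e * fst (g e)) - snd (g e), fst (g e))"
    by (auto simp: P_def up_def down_def)
  have "fst (g 1) = b" using g(2) [of 0] g0 by simp
  moreover have "row_recursion 0 (\<lambda>e. fst (g e))"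
    unfolding row_recursion_def by (simp add: g(2,3)) (simp add: c_def algebra_simps)
  ultimately show ?thesis
    using g0 g(1) by (intro exI [of _ "\<lambda>e. fst (g e)"]) auto
qed

lemma tetrahedron_index_exists:
  "\<exists>f. tetrahedron_index f \<and> f 0 0 = of_q a \<and> f 0 1 = of_q b"
proof -
  have "has_parity 0 (of_q a)" "has_parity 0 (of_q b)"
    by (auto simp: has_parity_0_iff)
  from row_exists [OF this] tetrahedron_index_exists_from_row show ?thesis by metis
qed

text \<open>At \<open>m = 0\<close> the parity condition says that the values are Laurent series in \<open>q\<close>.\<close>
lemma tetrahedron_index_initial:
  assumes "tetrahedron_index f" obtains a b where "f 0 0 = of_q a" "f 0 1 = of_q b"
proof -
  have "has_parity (0 * 0) (f 0 0)" "has_parity (1 * 0) (f 0 1)"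
    using assms unfolding tetrahedron_index_iff by blast+
  thus ?thesis using that by (auto simp: has_parity_0_iff)
qed

lemma has_parity_of_q_mult: "has_parity p f \<Longrightarrow> has_parity p (of_q c * f)"
proof -
  assume "has_parity p f"
  then obtain g where "f = qh p * of_q g" by (auto simp: has_parity_iff)
  hence "of_q c * f = qh p * of_q (c * g)" by (simp add: mult.left_commute)
  thus ?thesis unfolding has_parity_iff by blast
qed

section \<open>The module of all tetrahedron indices\<close>

lemma row_up_add: "row_up m (u + v) = row_up m u + row_up m v"
  and row_down_add: "row_down m (u + v) = row_down m u + row_down m v"
  and row_up_mult: "row_up m (\<lambda>e. c * u e) = (\<lambda>e. c * row_up m u e)"
  and row_down_mult: "row_down m (\<lambda>e. c * u e) = (\<lambda>e. c * row_down m u e)"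
  by (simp_all add: row_up_def row_down_def fun_eq_iff algebra_simps)

lemma subspace_tet_V: "module.subspace laurent_scale tet_V"
proof -
  have "tetrahedron_index (f + g)" if "tetrahedron_index f" "tetrahedron_index g" for f g
    using that unfolding tetrahedron_index_iff tet_relations_iff_rows
    by (simp add: has_parity_add row_up_add row_down_add)
  moreover have "tetrahedron_index (laurent_scale c f)" if "tetrahedron_index f" for c f
    using that unfolding tetrahedron_index_iff tet_relations_iff_rows laurent_scale_def
    by (simp add: has_parity_of_q_mult row_up_mult row_down_mult)
  ultimately show ?thesis
    unfolding module.subspace_def [OF module_laurent_scale] tet_V_def
    by (auto simp: tetrahedron_index_def intro: exI [of _ 0])
qed

text \<open>
  The basis consists of the solutions with initial values \<open>(1, 0)\<close> and \<open>(0, 1)\<close>, and the coordinates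
  of a solution are its own initial values.
\<close>
lemma free_tet_V: "free_module_of_rank laurent_scale tet_V 2"
proof -
  interpret module laurent_scale by (rule module_laurent_scale)
  obtain f where f: "tetrahedron_index f" "f 0 0 = 1" "f 0 1 = 0"
    using tetrahedron_index_exists [of 1 0] by auto
  obtain g where g: "tetrahedron_index g" "g 0 0 = 0" "g 0 1 = 1"
    using tetrahedron_index_exists [of 0 1] by auto
  have fg: "f \<noteq> g" using f g by auto
  have "independent {f, g}"
  proof (subst dependent_finite, simp, clarify)
    fix u v assume "v \<in> {f, g}" "u v \<noteq> 0" "(\<Sum>v\<in>{f, g}. laurent_scale (u v) v) = 0"
    hence "laurent_scale (u f) f m e + laurent_scale (u g) g m e = 0" for m e
      using fg by (simp add: fun_eq_iff)
    from this [of 0 0] this [of 0 1] show False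
      using f g \<open>v \<in> {f, g}\<close> \<open>u v \<noteq> 0\<close> by (auto simp: laurent_scale_def)
  qed
  moreover have "span {f, g} = tet_V"
  proof (rule span_subspace)
    show "{f, g} \<subseteq> tet_V" using f g by (auto simp: tet_V_def)
    show "tet_V \<subseteq> span {f, g}"
    proof
      fix h assume h: "h \<in> tet_V"
      then obtain a b where ab: "h 0 0 = of_q a" "h 0 1 = of_q b"
        unfolding tet_V_def using tetrahedron_index_initial by blast
      have "laurent_scale a f + laurent_scale b g \<in> tet_V"
        using f g subspace_tet_V by (intro subspace_add subspace_scale) (auto simp: tet_V_def)
      hence "h = laurent_scale a f + laurent_scale b g"
        using h ab f g by (intro tet_relations_eqI)
          (auto simp: tet_V_def tetrahedron_index_iff laurent_scale_def)
      thus "h \<in> span {f, g}"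
        by (simp add: span_add span_base span_scale)
    qed
  qed (rule subspace_tet_V)
  ultimately show ?thesis
    unfolding free_module_of_rank_def using fg
    by (intro conjI module_laurent_scale subspace_tet_V exI [of _ "{f, g}"]) auto
qed

section \<open>A \<open>q\<close>-positive solution is determined by its value at the origin\<close>

lemma fls_subdegree_nonneg_iff: "fls_subdegree F \<ge> 0 \<longleftrightarrow> (\<exists>p. F = fps_to_fls p)"
  by (metis fls_regpart_to_fls_trivial fls_subdegree_fls_to_fps_gt0)

lemma q_positive_iff: "q_positive f \<longleftrightarrow> (\<forall>m e. \<exists>p. f m e = fps_to_fls p)"
  by (simp add: q_positive_def fls_subdegree_nonneg_iff)

lemma fps_to_fls_nth_neg: "n < 0 \<Longrightarrow> fps_to_fls p $$ n = 0"
  by simp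

lemma fps_to_fls_X_power: "fps_to_fls (fps_X ^ n) = (qh (int n) :: int fls)"
  by (simp add: fps_to_fls_power fls_X_power_conv_shift_1)

lemma qh_nonneg:
  assumes "k \<ge> 0" shows "\<exists>p. qh k * fps_to_fls q = fps_to_fls (p :: int fps)"
proof
  show "qh k * fps_to_fls q = fps_to_fls (fps_X ^ nat k * q)"
    using assms by (simp add: fls_times_fps_to_fls fps_to_fls_X_power)
qed

lemma neg_qh_nonneg:
  assumes "k \<ge> 0" shows "\<exists>p. neg_qh k * fps_to_fls q = fps_to_fls p"
proof -
  obtain p where "qh k * fps_to_fls q = fps_to_fls p" using qh_nonneg assms by blast
  hence "neg_qh k * fps_to_fls q = fps_to_fls (if even k then p else - p)"
    by (simp add: neg_qh_def)
  thus ?thesis by blast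
qed

lemma of_q_fps_to_fls: "of_q (fps_to_fls c) = fps_to_fls (c oo fps_X ^ 2)"
  by (simp add: of_q_def fls_compose_power_fps_to_fls)

lemma of_q_eq_fps_to_flsD:
  assumes "of_q a = fps_to_fls p" shows "\<exists>c. a = fps_to_fls c"
proof -
  have "a $$ n = 0" if "n < 0" for n
    using arg_cong [OF assms, of "\<lambda>F. F $$ (2 * n)"] that by (simp add: of_q_nth)
  hence "fls_subdegree a \<ge> 0" by (intro fls_subdegree_ge0I)
  thus ?thesis by (simp add: fls_subdegree_nonneg_iff)
qed

text \<open>
  In the row \<open>m = 0\<close> the recursion reads \<open>u (e - 1) = (2 - q\<^sup>e) u e - u (e + 1)\<close>.  For \<open>e < 0\<close>
  the term \<open>q\<^sup>e u e\<close> has strictly the lowest degree on the right as soon as the degree of \<open>u e\<close>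
  does not exceed that of \<open>u (e + 1)\<close>, which is then true of the next pair as well; it is true at
  \<open>e = -1\<close> because \<open>u 0 = 0\<close>.
\<close>
lemma q_positive_eq_0:
  assumes f: "tet_relations f" and pos: "q_positive f" and f00: "f 0 0 = 0"
  shows "f = 0"
proof -
  define u where "u = f 0"
  have u: "u (e - 1) = u e + u e - qh (2 * e) * u e - u (e + 1)" for e
    using row_recursionD [OF tet_relations_row_recursion [OF f], of 0 e]
    by (simp add: u_def algebra_simps)
  have neg: "u e $$ k = 0" if "k < 0" for e k
    using pos fps_to_fls_nth_neg [OF that] unfolding q_positive_iff u_def by metis
  have u0: "u 0 = 0" by (simp add: u_def f00)
  have "u (- 1) = 0"
  proof (rule ccontr)
    assume nz: "u (- 1) \<noteq> 0"
    define d where "d = fls_subdegree (u (- 1))"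
    \<comment> \<open>The degree of \<open>u (- n - 1)\<close>: the step from \<open>u (- n)\<close> lowers it by \<open>2 n\<close>, because the exponents
      are those of \<open>q\<^sup>1\<^sup>/\<^sup>2\<close>.\<close>
    define c where "c n = d - int n * (int n + 1)" for n
    have "u (- int n - 1) $$ c n \<noteq> 0 \<and>
          (\<forall>k < c n. u (- int n - 1) $$ k = 0) \<and> (\<forall>k < c n. u (- int n) $$ k = 0)" for n
    proof (induction n)
      case 0
      show ?case using nz by (simp add: c_def d_def u0)
    next
      case (Suc n)
      define e where "e = - int n - 1"
      have c: "c (Suc n) = c n + 2 * e" by (simp add: c_def e_def algebra_simps)
      have "u (e - 1) $$ k = u e $$ k + u e $$ k - u e $$ (k - 2 * e) - u (e + 1) $$ k" for k
        by (simp add: u fls_X_intpow_times_conv_shift)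
      moreover have "e < 0" by (simp add: e_def)
      moreover have "u e $$ c n \<noteq> 0" "\<And>k. k < c n \<Longrightarrow> u e $$ k = 0"
        "\<And>k. k < c n \<Longrightarrow> u (e + 1) $$ k = 0"
        using Suc by (simp_all add: e_def)
      ultimately have "u (e - 1) $$ (c n + 2 * e) \<noteq> 0 \<and> (\<forall>k < c n + 2 * e. u (e - 1) $$ k = 0) \<and>
                       (\<forall>k < c n + 2 * e. u e $$ k = 0)"
        by simp
      moreover have "- int (Suc n) = e" by (simp add: e_def)
      ultimately show ?case unfolding c by metis
    qed
    moreover have "c (nat \<bar>d\<bar> + 1) < 0"
      by (simp add: c_def algebra_simps) (smt (verit) mult_nonneg_nonneg zero_le_square)
    ultimately show False using neg by blast
  qed
  hence "u 1 = 0" using u [of 0] u0 by simp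
  thus ?thesis
    using f f00 by (intro tet_relations_eqI) (auto simp: u_def tet_relations_def)
qed

section \<open>The tetrahedron index series in a quadrant\<close>

text \<open>
  The infinite sum of power series whose terms satisfy the condition \<open>escaping\<close> below: then the terms
  beyond the \<open>N\<close>-th do not contribute to the coefficient at \<open>N\<close>, and truncating there is the same as
  truncating at any later place.  A truncation that depends on the coefficient commutes with
  differences, and for escaping terms also with shifts of the summation index and with
  multiplication by monomials.
\<close>
definition fps_series :: "(nat \<Rightarrow> int fps) \<Rightarrow> int fps" where
  "fps_series t = Abs_fps (\<lambda>N. \<Sum>n\<le>N. t n $ N)"

lemma fps_series_diff: "fps_series (\<lambda>n. s n - t n) = fps_series s - fps_series t"
  by (simp add: fps_eq_iff fps_series_def sum_subtractf)

definition escaping :: "(nat \<Rightarrow> int fps) \<Rightarrow> bool" where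
  "escaping t \<longleftrightarrow> (\<forall>n j. j < n \<longrightarrow> t n $ j = 0)"

lemma fps_series_nth:
  assumes "escaping t" "N \<le> M" shows "fps_series t $ N = (\<Sum>n\<le>M. t n $ N)"
proof -
  have "(\<Sum>n\<le>M. t n $ N) = (\<Sum>n\<le>N. t n $ N)"
    using assms by (intro sum.mono_neutral_right) (auto simp: escaping_def)
  thus ?thesis by (simp add: fps_series_def)
qed

lemma fps_series_X_power_mult:
  assumes "escaping t" shows "fps_series (\<lambda>n. fps_X ^ i * t n) = fps_X ^ i * fps_series t"
proof (rule fps_ext)
  fix N show "fps_series (\<lambda>n. fps_X ^ i * t n) $ N = (fps_X ^ i * fps_series t) $ N"
    using fps_series_nth [OF assms, of "N - i" N]
    by (simp add: fps_series_def [of "\<lambda>n. fps_X ^ i * t n"] fps_X_power_mult_nth)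
qed

lemma fps_series_Suc:
  assumes "escaping t" "t 0 = 0" shows "fps_series (\<lambda>n. t (Suc n)) = fps_series t"
proof (rule fps_ext)
  fix N
  have "fps_series t $ N = (\<Sum>n\<le>Suc N. t n $ N)"
    using assms by (intro fps_series_nth) auto
  also have "\<dots> = (\<Sum>n\<le>N. t (Suc n) $ N)"
    using assms by (subst sum.atMost_Suc_shift) simp
  finally show "fps_series (\<lambda>n. t (Suc n)) $ N = fps_series t $ N"
    by (simp add: fps_series_def)
qed

text \<open>
  The reciprocal of the \<open>q\<close>-factorial \<open>(1 - q) \<cdots> (1 - q\<^sup>n)\<close>.  As \<^typ>\<open>int\<close> is not a field, the
  inverse of a factor is taken as its right inverse with constant coefficient 1.
\<close>
primrec inv_qfact :: "nat \<Rightarrow> int fps" where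
  "inv_qfact 0 = 1"
| "inv_qfact (Suc n) = inv_qfact n * fps_right_inverse (1 - fps_X ^ Suc n) 1"

lemma inv_qfact_Suc_mult: "(1 - fps_X ^ Suc n) * inv_qfact (Suc n) = inv_qfact n"
proof -
  have "(1 - fps_X ^ Suc n) * fps_right_inverse (1 - fps_X ^ Suc n) 1 = (1 :: int fps)"
    by (rule fps_right_inverse) simp
  thus ?thesis by (simp add: mult.left_commute)
qed

lemma X_mult_inv_qfact: "fps_X ^ Suc n * inv_qfact (Suc n) = inv_qfact (Suc n) - inv_qfact n"
  using inv_qfact_Suc_mult [of n] by (simp only: left_diff_distrib mult_1 algebra_simps)

text \<open>
  The summand of the tetrahedron index at \<open>m = - k \<le> 0\<close> and \<open>e \<ge> 0\<close>, without the factor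
  \<open>q\<^bsup>- e m / 2\<^esup>\<close>.  In this quadrant all exponents are natural numbers and no summand vanishes
  because of a negative index of the \<open>q\<close>-factorial.
\<close>
definition tet_term :: "nat \<Rightarrow> nat \<Rightarrow> nat \<Rightarrow> int fps" where
  "tet_term k e n = (-1) ^ n * fps_X ^ (triangle n + n * k) * inv_qfact n * inv_qfact (n + e)"

definition tet_series :: "nat \<Rightarrow> nat \<Rightarrow> int fps" where
  "tet_series k e = fps_series (tet_term k e)"

lemma escaping_tet_term: "escaping (tet_term k e)"
proof -
  have "n \<le> triangle n" for n by (induction n) simp_all
  hence "n \<le> triangle n + n * k" for n using trans_le_add1 by blast
  moreover have "tet_term k e n =
      fps_X ^ (triangle n + n * k) * ((-1) ^ n * inv_qfact n * inv_qfact (n + e))" for n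
    by (simp add: tet_term_def mult_ac)
  ultimately show ?thesis
    unfolding escaping_def by (auto simp: fps_X_power_mult_nth dest: less_le_trans)
qed

text \<open>
  Raising \<open>k\<close> multiplies the \<open>n\<close>-th term by \<open>q\<^sup>n\<close>.  The difference has the factor \<open>1 - q\<^sup>n\<close>,
  which cancels against the \<open>q\<close>-factorial of \<open>n\<close> and kills the term \<open>n = 0\<close>; after shifting the
  summation index the right-hand series remains.
\<close>
lemma tet_series_relation1:
  "tet_series k e + fps_X ^ Suc k * tet_series (Suc k) (Suc e) = tet_series (Suc k) e"
proof -
  define d where "d n = tet_term (Suc k) e n - tet_term k e n" for n
  have "escaping d"
    using escaping_tet_term unfolding escaping_def d_def by simp
  have "d (Suc n) = fps_X ^ Suc k * tet_term (Suc k) (Suc e) n" for n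
  proof -
    have "d (Suc n) = (-1) ^ n * fps_X ^ (triangle (Suc n) + Suc n * k) *
        ((1 - fps_X ^ Suc n) * inv_qfact (Suc n)) * inv_qfact (Suc n + e)"
      unfolding d_def tet_term_def mult_Suc_right add_Suc by (simp add: power_add algebra_simps)
    also have "\<dots> = fps_X ^ Suc k * tet_term (Suc k) (Suc e) n"
      unfolding inv_qfact_Suc_mult tet_term_def by (simp add: power_add mult_ac del: inv_qfact.simps)
    finally show ?thesis .
  qed
  hence "fps_X ^ Suc k * tet_series (Suc k) (Suc e) = fps_series (\<lambda>n. d (Suc n))"
    by (simp only: tet_series_def fps_series_X_power_mult [OF escaping_tet_term])
  also have "\<dots> = fps_series d"
    by (rule fps_series_Suc [OF \<open>escaping d\<close>]) (simp add: d_def tet_term_def)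
  also have "\<dots> = tet_series (Suc k) e - tet_series k e"
    unfolding d_def tet_series_def by (rule fps_series_diff)
  finally show ?thesis by simp
qed

text \<open>
  Here the relation holds term by term: it is \<open>X_mult_inv_qfact\<close> for the second \<open>q\<close>-factorial, of
  index \<open>n + e + 1\<close>.
\<close>
lemma tet_series_relation2:
  "fps_X ^ Suc e * tet_series (Suc k) (Suc e) + tet_series k e = tet_series k (Suc e)"
proof -
  have "fps_X ^ Suc e * tet_term (Suc k) (Suc e) n = tet_term k (Suc e) n - tet_term k e n" for n
  proof -
    have "fps_X ^ Suc e * tet_term (Suc k) (Suc e) n =
        (-1) ^ n * fps_X ^ (triangle n + n * k) * inv_qfact n *
          (fps_X ^ Suc (n + e) * inv_qfact (Suc (n + e)))"
      unfolding tet_term_def by (simp add: power_add mult_ac del: inv_qfact.simps)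
    also have "\<dots> = tet_term k (Suc e) n - tet_term k e n"
      unfolding X_mult_inv_qfact tet_term_def by (simp add: algebra_simps del: inv_qfact.simps)
    finally show ?thesis .
  qed
  hence "fps_X ^ Suc e * tet_series (Suc k) (Suc e) =
         fps_series (\<lambda>n. tet_term k (Suc e) n - tet_term k e n)"
    by (simp only: tet_series_def flip: fps_series_X_power_mult [OF escaping_tet_term])
  also have "\<dots> = tet_series k (Suc e) - tet_series k e"
    unfolding tet_series_def by (rule fps_series_diff)
  finally show ?thesis by simp
qed

lemma tet_series_0_nth_0: "tet_series 0 0 $ 0 = 1"
  by (simp add: tet_series_def fps_series_def tet_term_def)

text \<open>
  The relations of all triangles that lie in the quadrant \<open>m \<le> 0 \<le> e\<close>, with \<open>k = - m\<close>.  They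
  suffice to determine a function on the quadrant by its two initial values, so the
  series and the solution with the same initial values coincide there.
\<close>
definition tet_quadrant :: "(nat \<Rightarrow> nat \<Rightarrow> int fls) \<Rightarrow> bool" where
  "tet_quadrant D \<longleftrightarrow>
     (\<forall>k e. qh (int e) * D k e + qh (int k + 1) * D (Suc k) (Suc e) = D (Suc k) e) \<and>
     (\<forall>k e. qh (int e + 1) * D (Suc k) (Suc e) + qh (int k) * D k e = D k (Suc e))"

lemma tet_quadrant_diff:
  "tet_quadrant D \<Longrightarrow> tet_quadrant D' \<Longrightarrow> tet_quadrant (\<lambda>k e. D k e - D' k e)"
  unfolding tet_quadrant_def by (simp only: right_diff_distrib) (metis add_diff_add)

lemma tet_quadrant_eq_0:
  assumes D: "tet_quadrant D" and "D 0 0 = 0" "D 0 1 = 0" shows "D k e = 0"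
proof -
  have 1: "qh (int e) * D k e + qh (int k + 1) * D (Suc k) (Suc e) = D (Suc k) e"
   and 2: "qh (int e + 1) * D (Suc k) (Suc e) + qh (int k) * D k e = D k (Suc e)" for k e
    using D by (auto simp: tet_quadrant_def)
  have "D 0 e = 0 \<and> D 0 (Suc e) = 0" for e
  proof (induction e)
    case (Suc e)
    hence "D 1 (Suc e) = 0" using 2 [of e 0] by (simp add: fls_shift_eq0_iff)
    hence "D 1 (Suc (Suc e)) = 0" using 1 [of "Suc e" 0] Suc by (simp add: fls_shift_eq0_iff)
    thus ?case using 2 [of "Suc e" 0] Suc by simp
  qed (use assms in simp)
  thus "D k e = 0"
  proof (induction k arbitrary: e)
    case (Suc k)
    hence "D (Suc k) (Suc e) = 0" for e using 2 [of e k] by (simp add: fls_shift_eq0_iff)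
    thus ?case using 1 [of e k] Suc by simp
  qed simp
qed

lemma tet_relations_quadrant:
  assumes "tet_relations f" shows "tet_quadrant (\<lambda>k e. f (- int k) (int e))"
  unfolding tet_quadrant_def
proof (intro conjI allI)
  fix k e
  show "qh (int e) * f (- int k) (int e) + qh (int k + 1) * f (- int (Suc k)) (int (Suc e)) =
        f (- int (Suc k)) (int e)"
    using tet_relationsD(1) [OF assms, of "int e" "- int (Suc k)"] by (simp add: algebra_simps)
  have *: "- int (Suc k) = - int k - 1" by simp
  show "qh (int e + 1) * f (- int (Suc k)) (int (Suc e)) + qh (int k) * f (- int k) (int e) =
        f (- int k) (int (Suc e))"
    unfolding * using tet_relationsD(2) [OF assms, of "int (Suc e)" "- int k"]
    by (simp add: add.commute)
qed

lemma of_q_fps_X_power: "of_q (fps_to_fls (fps_X ^ n)) = qh (2 * int n)"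
  by (simp add: fps_to_fls_X_power)

lemma tet_series_quadrant:
  "tet_quadrant (\<lambda>k e. qh (int e * int k) * of_q (fps_to_fls (tet_series k e)))"
proof -
  let ?S = "\<lambda>k e. of_q (fps_to_fls (tet_series k e))"
  have 1: "?S (Suc k) e = ?S k e + qh (2 * int (Suc k)) * ?S (Suc k) (Suc e)" for k e
    unfolding tet_series_relation1 [of k e, symmetric] fps_to_fls_plus fls_times_fps_to_fls
      of_q_simps of_q_fps_X_power ..
  have 2: "?S k (Suc e) = qh (2 * int (Suc e)) * ?S (Suc k) (Suc e) + ?S k e" for k e
    unfolding tet_series_relation2 [of e k, symmetric] fps_to_fls_plus fls_times_fps_to_fls
      of_q_simps of_q_fps_X_power ..
  show ?thesis
    unfolding tet_quadrant_def
  proof (intro conjI allI)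
    fix k e
    show "qh (int e) * (qh (int e * int k) * ?S k e) +
          qh (int k + 1) * (qh (int (Suc e) * int (Suc k)) * ?S (Suc k) (Suc e)) =
          qh (int e * int (Suc k)) * ?S (Suc k) e"
      by (subst 1 [of k e]) (simp add: qh_simps algebra_simps, smt (verit))
    show "qh (int e + 1) * (qh (int (Suc e) * int (Suc k)) * ?S (Suc k) (Suc e)) +
          qh (int k) * (qh (int e * int k) * ?S k e) =
          qh (int (Suc e) * int k) * ?S k (Suc e)"
      by (subst 2 [of k e]) (simp add: qh_simps algebra_simps, smt (verit))
  qed
qed

text \<open>
  The three numbers \<open>m\<close>, \<open>e\<close>, \<open>- e - m\<close> add up to 0, so in their cyclic order some
  nonpositive one is followed by a nonnegative one.  The symmetry moves \<open>(m, e)\<close> to that pair, which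
  lies in the quadrant where the series shows positivity, and the exponents of \<open>-q\<^sup>1\<^sup>/\<^sup>2\<close> that appear,
  \<open>- e\<close> and \<open>m\<close>, are nonnegative in the respective cases.
\<close>
lemma q_positive_index_exists:
  "\<exists>f. tetrahedron_index f \<and> q_positive f \<and> f 0 0 = of_q (fps_to_fls (tet_series 0 0))"
proof -
  obtain f where f: "tetrahedron_index f" and f0: "f 0 0 = of_q (fps_to_fls (tet_series 0 0))"
    "f 0 1 = of_q (fps_to_fls (tet_series 0 1))"
    using tetrahedron_index_exists by blast
  have rel: "tet_relations f" using f by (simp add: tetrahedron_index_iff)
  have eq: "f (- int k) (int e) = qh (int e * int k) * of_q (fps_to_fls (tet_series k e))" for k e
    using tet_quadrant_eq_0 [OF tet_quadrant_diff [OF tet_relations_quadrant [OF rel] tet_series_quadrant],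
        of k e] f0 by simp
  have quadrant: "\<exists>p. f m e = fps_to_fls p" if "m \<le> 0" "e \<ge> 0" for m e
  proof -
    obtain k l where "m = - int k" "e = int l" using \<open>m \<le> 0\<close> \<open>e \<ge> 0\<close> by (metis minus_minus neg_0_le_iff_le nonneg_int_cases)
    thus ?thesis by (simp add: eq of_q_fps_to_fls qh_nonneg)
  qed
  have "\<exists>p. f m e = fps_to_fls p" for m e
  proof -
    consider "m \<le> 0" "e \<ge> 0" | "e \<le> 0" "- e - m \<ge> 0" | "- e - m \<le> 0" "m \<ge> 0" by linarith
    thus ?thesis
    proof cases
      case 1
      thus ?thesis by (rule quadrant)
    next
      case 2
      then obtain p where "f e (- e - m) = fps_to_fls p" using quadrant by blast
      thus ?thesis using neg_qh_nonneg [of "- e" p] 2 tet_relations_symmetry(1) [OF rel, of m e] by simp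
    next
      case 3
      then obtain p where "f (- e - m) m = fps_to_fls p" using quadrant by blast
      thus ?thesis using neg_qh_nonneg [of m p] 3 tet_relations_symmetry(2) [OF rel, of m e] by simp
    qed
  qed
  with f f0 show ?thesis by (auto simp: q_positive_iff)
qed

section \<open>The module of \<open>q\<close>-positive tetrahedron indices\<close>

lemma subspace_tet_V_pos: "module.subspace power_scale tet_V_pos"
proof -
  note sub = subspace_tet_V [unfolded module.subspace_def [OF module_laurent_scale]]
  have "f + g \<in> tet_V_pos" if "f \<in> tet_V_pos" "g \<in> tet_V_pos" for f g
    using that sub unfolding tet_V_pos_def q_positive_iff
    by (auto simp flip: fps_to_fls_plus) (metis fps_to_fls_plus)
  moreover have "power_scale c f \<in> tet_V_pos" if "f \<in> tet_V_pos" for c f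
  proof -
    have f: "\<exists>p. f m e = fps_to_fls p" for m e
      using that by (simp add: tet_V_pos_def q_positive_iff)
    have "\<exists>p. power_scale c f m e = fps_to_fls p" for m e
    proof -
      obtain p where "f m e = fps_to_fls p" using f by blast
      hence "power_scale c f m e = fps_to_fls ((c oo fps_X ^ 2) * p)"
        by (simp add: power_scale_def laurent_scale_def of_q_fps_to_fls fls_times_fps_to_fls)
      thus ?thesis ..
    qed
    moreover have "power_scale c f \<in> tet_V"
      using that sub unfolding tet_V_pos_def power_scale_def by blast
    ultimately show ?thesis by (simp add: tet_V_pos_def q_positive_iff)
  qed
  moreover have "0 \<in> tet_V_pos"
    using sub by (auto simp: tet_V_pos_def q_positive_iff intro: exI [of _ 0])
  ultimately show ?thesis
    unfolding module.subspace_def [OF module_power_scale] by blast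
qed

text \<open>
  The value \<open>S\<close> of the generator at the origin is an invertible power series, so a multiple of the
  generator can be subtracted from any \<open>q\<close>-positive solution to make it vanish at the origin, and
  then it vanishes everywhere.
\<close>
lemma free_tet_V_pos: "free_module_of_rank power_scale tet_V_pos 1"
proof -
  interpret module power_scale by (rule module_power_scale)
  define S where "S = tet_series 0 0"
  obtain f where f: "tetrahedron_index f" "q_positive f" "f 0 0 = of_q (fps_to_fls S)"
    using q_positive_index_exists unfolding S_def by blast
  hence fV: "f \<in> tet_V_pos" by (simp add: tet_V_pos_def tet_V_def)
  have S0: "S $ 0 = 1" by (simp add: S_def tet_series_0_nth_0)
  have scale0: "power_scale c f 0 0 = of_q (fps_to_fls (c * S))" for c
    by (simp add: power_scale_def laurent_scale_def f fls_times_fps_to_fls)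
  have "c = 0" if "power_scale c f = 0" for c
  proof -
    have "power_scale c f 0 0 = 0" using that by simp
    hence "c * S = 0" by (simp add: scale0)
    moreover have "S \<noteq> 0" using S0 by auto
    ultimately show "c = 0" by simp
  qed
  hence "independent {f}" by (auto simp: dependent_finite)
  moreover have "span {f} = tet_V_pos"
  proof (rule span_subspace)
    show "tet_V_pos \<subseteq> span {f}"
    proof
      fix h assume h: "h \<in> tet_V_pos"
      hence hV: "tetrahedron_index h" "q_positive h" by (simp_all add: tet_V_pos_def tet_V_def)
      obtain a where a: "h 0 0 = of_q a"
        using tetrahedron_index_initial [OF hV(1)] by blast
      moreover obtain p where "h 0 0 = fps_to_fls p"
        using hV(2) by (auto simp: q_positive_iff)
      ultimately obtain b where b: "a = fps_to_fls b"
        using of_q_eq_fps_to_flsD by metis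
      define c where "c = b * fps_right_inverse S 1"
      have "S * fps_right_inverse S 1 = 1" using S0 by (intro fps_right_inverse) simp
      hence "c * S = b" by (simp add: c_def mult_ac)
      define g where "g = h - power_scale c f"
      have "g \<in> tet_V_pos"
        unfolding g_def by (intro subspace_diff subspace_scale subspace_tet_V_pos h fV)
      moreover have "g 0 0 = 0"
        by (simp add: g_def scale0 a b \<open>c * S = b\<close>)
      ultimately have "g = 0"
        by (intro q_positive_eq_0) (auto simp: tet_V_pos_def tet_V_def tetrahedron_index_iff)
      hence "h = power_scale c f" by (simp add: g_def)
      thus "h \<in> span {f}" by (simp add: span_base span_scale)
    qed
  qed (use fV subspace_tet_V_pos in auto)
  ultimately show ?thesis
    unfolding free_module_of_rank_def
    by (intro conjI module_power_scale subspace_tet_V_pos exI [of _ "{f}"]) auto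
qed

section \<open>Holonomicity\<close>

lemma fls_of_int_coeffs_nth: "fls_of_int_coeffs f $$ n = of_int (f $$ n)"
  by transfer simp

lemma fls_of_int_coeffs_add: "fls_of_int_coeffs (f + g) = fls_of_int_coeffs f + fls_of_int_coeffs g"
  and fls_of_int_coeffs_diff: "fls_of_int_coeffs (f - g) = fls_of_int_coeffs f - fls_of_int_coeffs g"
  and fls_of_int_coeffs_qh_mult: "fls_of_int_coeffs (qh k * f) = qh k * fls_of_int_coeffs f"
  by (rule fls_eqI; simp add: fls_of_int_coeffs_nth fls_X_intpow_times_conv_shift)+

lemma fls_of_fract_qh: "\<exists>c. fls_of_fract c = qh k"
proof -
  have *: "fps_to_fls (fps_of_poly (monom 1 n)) = (qh (int n) :: rat fls)" for n
    by (simp add: fps_of_poly_monom fps_to_fls_power fls_X_power_conv_shift_1)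
  have "fls_of_fract (Fract (monom 1 (nat k)) (monom 1 (nat (- k)))) = qh (int (nat k) - int (nat (- k)))"
    by (simp add: fls_of_fract_Fract * fls_X_intpow_div_fls_X_intpow del: of_nat_nat int_nat_eq)
  also have "int (nat k) - int (nat (- k)) = k" by simp
  finally show ?thesis by blast
qed

text \<open>
  Multiplication by the monomial \<open>(q\<^bsup>m/2\<^esup>)\<^sup>i (q\<^bsup>e/2\<^esup>)\<^sup>j\<close>.  Negative exponents are
  needed because the relations involve inverse powers of \<open>q\<^bsup>m/2\<^esup>\<close> and \<open>q\<^bsup>e/2\<^esup>\<close>.
\<close>
definition twist :: "int \<Rightarrow> int \<Rightarrow> (int \<Rightarrow> int \<Rightarrow> rat fls) \<Rightarrow> (int \<Rightarrow> int \<Rightarrow> rat fls)" where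
  "twist i j h = (\<lambda>m e. qh (i * m + j * e) * h m e)"

definition twists :: "(int \<Rightarrow> int \<Rightarrow> rat fls) \<Rightarrow> nat \<Rightarrow> (int \<Rightarrow> int \<Rightarrow> rat fls) set" where
  "twists g D = (\<lambda>(i, j, h). twist i j h) ` ({- int D..int D} \<times> {- int D..int D} \<times> {g, L2 g})"

lemma finite_twists: "finite (twists g D)"
  by (simp add: twists_def)

lemma card_twists: "card (twists g D) \<le> 2 * (2 * D + 1) ^ 2"
proof -
  have "card (twists g D) \<le> card ({- int D..int D} \<times> {- int D..int D} \<times> {g, L2 g})"
    unfolding twists_def by (rule card_image_le) simp
  also have "\<dots> = (2 * D + 1) * ((2 * D + 1) * card {g, L2 g})"
    by (simp add: card_cartesian_product nat_add_distrib nat_mult_distrib)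
  also have "\<dots> \<le> (2 * D + 1) * ((2 * D + 1) * 2)"
    by (intro mult_le_mono le_refl) (simp add: card_insert_if)
  finally show ?thesis by (simp add: power2_eq_square mult_ac)
qed

lemma twists_mono: "D \<le> D' \<Longrightarrow> twists g D \<subseteq> twists g D'"
  unfolding twists_def by (intro image_mono Sigma_mono) auto

lemma twist_in_twists:
  assumes "\<bar>i\<bar> \<le> int D" "\<bar>j\<bar> \<le> int D" "h = g \<or> h = L2 g" shows "twist i j h \<in> twists g D"
  unfolding twists_def by (rule image_eqI [where x = "(i, j, h)"]) (use assms in auto)

interpretation ratfun: vector_space ratfun_scale
  by (rule vector_space_ratfun_scale)

text \<open>
  Shifting a monomial in \<open>q\<^bsup>m/2\<^esup>\<close> and \<open>q\<^bsup>e/2\<^esup>\<close> produces constant powers of \<open>q\<^sup>1\<^sup>/\<^sup>2\<close>, which are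
  harmless because they come from the field of rational functions.
\<close>
definition qh_scale :: "int \<Rightarrow> (int \<Rightarrow> int \<Rightarrow> rat fls) \<Rightarrow> (int \<Rightarrow> int \<Rightarrow> rat fls)" where
  "qh_scale k h = (\<lambda>m e. qh k * h m e)"

lemma qh_scale_span: "h \<in> ratfun.span S \<Longrightarrow> qh_scale k h \<in> ratfun.span S"
proof -
  assume h: "h \<in> ratfun.span S"
  obtain c where "fls_of_fract c = qh k" using fls_of_fract_qh by blast
  hence "qh_scale k h = ratfun_scale c h" by (simp add: qh_scale_def ratfun_scale_def)
  thus ?thesis using h by (simp add: ratfun.span_scale)
qed

definition ratfun_linear where
  "ratfun_linear T \<longleftrightarrow> (\<forall>g h. T (g + h) = T g + T h) \<and> (\<forall>c h. T (ratfun_scale c h) = ratfun_scale c (T h))"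

lemma ratfun_linear_span:
  assumes T: "ratfun_linear T" and S: "\<And>h. h \<in> S \<Longrightarrow> T h \<in> ratfun.span S'"
    and "h \<in> ratfun.span S"
  shows "T h \<in> ratfun.span S'"
proof -
  have "T 0 = 0"
    using T unfolding ratfun_linear_def by (metis add_cancel_right_right)
  hence "ratfun.subspace {h. T h \<in> ratfun.span S'}"
    using T unfolding ratfun_linear_def ratfun.subspace_def
    by (auto intro: ratfun.span_add ratfun.span_scale ratfun.span_zero)
  thus ?thesis
    using ratfun.span_minimal [of S "{h. T h \<in> ratfun.span S'}"] assms by auto
qed

lemma ratfun_linear_operators:
  "ratfun_linear M1" "ratfun_linear M2" "ratfun_linear L1" "ratfun_linear L2"
  by (auto simp: ratfun_linear_def M1_def M2_def L1_def L2_def ratfun_scale_def fun_eq_iff algebra_simps)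

lemma operators_twist:
  "M1 (twist i j h) = twist (i + 1) j h"
  "M2 (twist i j h) = twist i (j + 1) h"
  "L1 (twist i j h) = qh_scale i (twist i j (L1 h))"
  "L2 (twist i j h) = qh_scale j (twist i j (L2 h))"
proof -
  have qh: "qh a * (qh b * F) = qh c * F" if "a + b = c" for a b c and F :: "rat fls"
    using that by (simp add: fls_X_intpow_times_fls_X_intpow flip: mult.assoc)
  show "M1 (twist i j h) = twist (i + 1) j h" "M2 (twist i j h) = twist i (j + 1) h"
    by (auto simp only: M1_def M2_def twist_def intro!: ext qh) (simp_all add: algebra_simps)
  show "L1 (twist i j h) = qh_scale i (twist i j (L1 h))"
       "L2 (twist i j h) = qh_scale j (twist i j (L2 h))"
    by (auto simp only: L1_def L2_def twist_def qh_scale_def intro!: ext qh [symmetric])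
       (simp_all add: algebra_simps)
qed

text \<open>
  Each of the four operators raises the degree of the monomials by at most 2: multiplications by 1,
  and shifts by as much as the Laurent polynomials by which the relations rewrite \<open>L1 g\<close>,
  \<open>L1 (L2 g)\<close> and \<open>L2 (L2 g)\<close>.
\<close>
lemma operators_span_twists:
  assumes L1: "\<And>m e. g (m + 1) e = qh (- e) * g m e - qh (- e - m) * g m (e + 1)"
    and L2: "\<And>m e. g m (e + 2) =
               qh m * g m (e + 1) + qh (- m) * g m (e + 1) - qh (2 * e + 2 + m) * g m (e + 1) - g m e"
    and L12: "\<And>m e. g (m + 1) (e + 1) = qh (e + 1) * g m (e + 1) + qh (- m - 1) * g (m + 1) e"
    and T: "T \<in> {M1, M2, L1, L2}" and h: "h \<in> ratfun.span (twists g D)"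
  shows "T h \<in> ratfun.span (twists g (D + 2))"
proof -
  define D' where "D' = D + 2"
  have "T h \<in> ratfun.span (twists g D')"
  proof (rule ratfun_linear_span [OF _ _ h])
    show "ratfun_linear T" using T ratfun_linear_operators by auto
  next
    fix t assume "t \<in> twists g D"
    then obtain i j h where t: "t = twist i j h" and h: "h = g \<or> h = L2 g"
      and ij: "\<bar>i\<bar> \<le> int D" "\<bar>j\<bar> \<le> int D"
      unfolding twists_def by auto
    let ?W = "ratfun.span (twists g D')"
    have W: "twist i' j' h \<in> ?W" if "\<bar>i' - i\<bar> \<le> 2" "\<bar>j' - j\<bar> \<le> 2" "h = g \<or> h = L2 g" for i' j' h
    proof -
      have "\<bar>i'\<bar> \<le> int D'" "\<bar>j'\<bar> \<le> int D'" using that ij by (simp_all add: D'_def)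
      thus ?thesis using that(3) by (intro ratfun.span_base twist_in_twists)
    qed
    \<comment> \<open>The relation \<open>L1\<close> is wanted only for the entry at \<open>(m + 1, e)\<close>.  Applied to the left-hand side
      as well, it would bring in an entry at \<open>e + 2\<close>.\<close>
    have L12': "g (m + 1) (e + 1) = qh (e + 1) * g m (e + 1) +
        qh (- m - 1) * (qh (- e) * g m e - qh (- e - m) * g m (e + 1))" for m e
      using L12 [of m e] unfolding L1 [of m e] .
    have "twist i j (L1 g) = twist i (j - 1) g - twist (i - 1) (j - 1) (L2 g)"
      by (simp add: fun_eq_iff twist_def L1_def L2_def L1 qh_simps algebra_simps)
    moreover have "twist i j (L1 (L2 g)) = qh_scale 1 (twist i (j + 1) (L2 g)) +
        qh_scale (-1) (twist (i - 1) (j - 1) g - twist (i - 2) (j - 1) (L2 g))"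
      unfolding L1_def L2_def L12' by (simp add: fun_eq_iff twist_def qh_scale_def qh_simps algebra_simps)
    moreover have "twist i j (L2 (L2 g)) = twist (i + 1) j (L2 g) + twist (i - 1) j (L2 g)
        - qh_scale 2 (twist (i + 1) (j + 2) (L2 g)) - twist i j g"
      by (simp add: fun_eq_iff twist_def L2_def qh_scale_def L2 add.assoc qh_simps)
         (simp add: qh_simps algebra_simps, smt (verit))
    ultimately show "T t \<in> ?W"
      using T h unfolding t
      by (auto simp: operators_twist intro!: W qh_scale_span ratfun.span_add ratfun.span_diff)
  qed
  thus ?thesis by (simp only: D'_def)
qed

text \<open>
  A monomial of order at most \<open>N\<close> in the operators maps \<open>g\<close> into the span of the twists of degree at
  most \<open>2 N\<close>, and there are at most \<open>2 (4 N + 1)\<^sup>2\<close> of these.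
\<close>
lemma q_holonomic_of_relations:
  assumes L1: "\<And>m e. g (m + 1) e = qh (- e) * g m e - qh (- e - m) * g m (e + 1)"
    and L2: "\<And>m e. g m (e + 2) =
               qh m * g m (e + 1) + qh (- m) * g m (e + 1) - qh (2 * e + 2 + m) * g m (e + 1) - g m e"
    and L12: "\<And>m e. g (m + 1) (e + 1) = qh (e + 1) * g m (e + 1) + qh (- m - 1) * g (m + 1) e"
  shows "q_holonomic g"
proof -
  have funpow: "(T ^^ n) h \<in> ratfun.span (twists g (2 * (N + n)))"
    if "T \<in> {M1, M2, L1, L2}" "h \<in> ratfun.span (twists g (2 * N))" for T n h N
  proof (induction n)
    case (Suc n)
    show ?case
      using operators_span_twists [OF L1 L2 L12 that(1) Suc] by (simp add: add.commute)
  qed (use that in simp)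
  have "g \<in> ratfun.span (twists g (2 * 0))"
    using twist_in_twists [of 0 0 0 g g] by (auto simp: twist_def intro: ratfun.span_base)
  hence "(M1 ^^ a1) ((M2 ^^ a2) ((L1 ^^ b1) ((L2 ^^ b2) g))) \<in>
           ratfun.span (twists g (2 * (0 + b2 + b1 + a2 + a1)))" for a1 a2 b1 b2
    by (intro funpow) auto
  moreover have "ratfun.span (twists g (2 * (0 + b2 + b1 + a2 + a1))) \<subseteq> ratfun.span (twists g (2 * N))"
    if "a1 + a2 + b1 + b2 \<le> N" for a1 a2 b1 b2 N
    by (intro ratfun.span_mono twists_mono) (use that in simp)
  ultimately have "monomials_upto g N \<subseteq> ratfun.span (twists g (2 * N))" for N
    unfolding monomials_upto_def by blast
  hence "ratfun.dim (monomials_upto g N) \<le> card (twists g (2 * N))" for N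
    by (rule ratfun.dim_le_card [OF _ finite_twists])
  hence dim: "ratfun.dim (ratfun.span (monomials_upto g N)) \<le> 2 * (4 * N + 1) ^ 2" for N
    using order_trans [OF _ card_twists [of g "2 * N"]] by simp
  have "norm (real (ratfun.dim (ratfun.span (monomials_upto g N)))) \<le> 50 * norm (real N ^ 2)"
    if "N \<ge> 1" for N
  proof -
    have "ratfun.dim (ratfun.span (monomials_upto g N)) \<le> 2 * (5 * N) ^ 2"
      using that by (intro order_trans [OF dim] mult_le_mono power_mono) auto
    hence "real (ratfun.dim (ratfun.span (monomials_upto g N))) \<le> real (2 * (5 * N) ^ 2)"
      by (simp only: of_nat_le_iff)
    thus ?thesis by (simp add: power_mult_distrib)
  qed
  thus ?thesis
    unfolding q_holonomic_def by (intro bigoI [of _ 50] eventually_at_top_linorderI [of 1])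
qed

lemma q_holonomic_tet_V: "q_holonomic_set tet_V"
  unfolding q_holonomic_set_def
proof
  fix f assume "f \<in> tet_V"
  hence f: "tet_relations f" by (simp add: tet_V_def tetrahedron_index_iff)
  have up: "f (m + 1) = row_up m (f m)" for m
    using f by (simp add: tet_relations_iff_rows)
  let ?g = "\<lambda>m e. fls_of_int_coeffs (f m e)"
  note hom = fls_of_int_coeffs_add fls_of_int_coeffs_diff fls_of_int_coeffs_qh_mult
  show "q_holonomic ?g"
  proof (rule q_holonomic_of_relations)
    fix m e
    have "f (m + 1) e = qh (- e) * f m e - qh (- e - m) * f m (e + 1)"
      unfolding up row_up_def by (simp add: qh_simps algebra_simps)
    thus "?g (m + 1) e = qh (- e) * ?g m e - qh (- e - m) * ?g m (e + 1)"
      by (simp only: hom)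
    have "f m (e + 2) = qh m * f m (e + 1) + qh (- m) * f m (e + 1)
            - qh (2 * e + 2 + m) * f m (e + 1) - f m e"
      using row_recursionD [OF tet_relations_row_recursion [OF f], of m "e + 1"]
      by (simp add: algebra_simps)
    thus "?g m (e + 2) = qh m * ?g m (e + 1) + qh (- m) * ?g m (e + 1)
            - qh (2 * e + 2 + m) * ?g m (e + 1) - ?g m e"
      by (simp only: hom)
    have "f (m + 1) (e + 1) = qh (e + 1) * f m (e + 1) + qh (- m - 1) * f (m + 1) e"
      using tet_relationsD(2) [OF f, of "e + 1" "m + 1"] by simp
    thus "?g (m + 1) (e + 1) = qh (e + 1) * ?g m (e + 1) + qh (- m - 1) * ?g (m + 1) e"
      by (simp only: hom)
  qed
qed

theorem theorem3p2:
  shows "(free_module_of_rank laurent_scale tet_V 2 \<and> q_holonomic_set tet_V)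
    \<and> (free_module_of_rank power_scale tet_V_pos 1 \<and> q_holonomic_set tet_V_pos)
    \<and> (\<forall>f\<in>tet_V. \<forall>m e.
           f m e = neg_qh (- e) * f e (- e - m) \<and>
           f m e = neg_qh m * f (- e - m) m)
    \<and> (\<forall>f\<in>tet_V. \<forall>m e.
           f m (e + 1) + (qh (2 * e + m) - qh (- m) - qh m) * f m e + f m (e - 1) = 0 \<and>
           f (m + 1) e + (qh (- e - 2 * m) - qh (- e) - qh e) * f m e + f (m - 1) e = 0)"
proof (intro conjI ballI allI)
  show "q_holonomic_set tet_V_pos"
    using q_holonomic_tet_V by (auto simp: q_holonomic_set_def tet_V_pos_def)
next
  fix f m e assume "f \<in> tet_V"
  hence f: "tet_relations f" by (simp add: tet_V_def tetrahedron_index_iff)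
  show "f m e = neg_qh (- e) * f e (- e - m)" "f m e = neg_qh m * f (- e - m) m"
    by (rule tet_relations_symmetry [OF f])+
  show "f m (e + 1) + (qh (2 * e + m) - qh (- m) - qh m) * f m e + f m (e - 1) = 0"
    using tet_relations_row_recursion [OF f] by (simp add: row_recursion_def)
  show "f (m + 1) e + (qh (- e - 2 * m) - qh (- e) - qh e) * f m e + f (m - 1) e = 0"
    by (rule tet_relations_column_recursion [OF f])
qed (rule free_tet_V free_tet_V_pos q_holonomic_tet_V)+

end
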